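(* Let $n\ge 2$. The set $\mathcal{F}^{1}_{n,2}$ is in bijection with the set $\mathcal{M}_{n-1}$ of magog triangles of size $n-1$. In particular $|\mathcal{F}^{1}_{n,2}| = |\mathcal{M}_{n-1}|$.
   Context: Let $[n]=\{1,\ldots,n\}$. The ground set of the poset $F_{n,2}$ consists of $\emptyset$ and all subsets of $[n]$ of size $1$ or $2$. Identify each nonempty such set $S$ with the pair $(a,b)$, where $a=\max S$ and $b$ is the other element of $S$ if $|S|=2$ and $b=0$ if $|S|=1$. The order of $F_{n,2}$: $\emptyset$ is the minimum, and $(a,b)\preceq(c,d)$ iff $a\le c$ and $b\le d$. A refinement of a poset is a partial order on the same ground set whose order relation contains the original one. $\mathcal{F}^{1}_{n,2}$ is the set of partial orders $P$ on the ground set of $F_{n,2}$ such that (i) $P$ refines $F_{n,2}$, (ii) every singleton set $\{i\}$ is comparable in $P$ with every element, and (iii) $P$ is minimal with respect to inclusion of order relations among all partial orders satisfying (i) and (ii). A magog triangle of size $m$ is an array of positive integers $M(i,j)$, $1\le j\le i\le m$, such that $1\le M(i,j)\le j$; $M(i,j)\le M(i+1,j)$ whenever both are defined (columns weakly increasing); and $M(i,j)\le M(i,j+1)$ whenever both are defined (rows weakly increasing). $\mathcal{M}_m$ denotes the set of magog triangles of size $m$. *)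

theory Defs
  imports "HOL-Library.FuncSet"
begin

definition F_ground :: "nat \<Rightarrow> nat set set" where
  "F_ground n = insert {} {S. S \<subseteq> {1..n} \<and> (card S = 1 \<or> card S = 2)}"

text \<open>The pair \<open>(a, b)\<close> that a nonempty ground set element is identified with.\<close>

definition pair_of :: "nat set \<Rightarrow> nat \<times> nat" where
  "pair_of S = (Max S, if card S = 2 then the_elem (S - {Max S}) else 0)"

definition F_order :: "nat \<Rightarrow> nat set rel" where
  "F_order n = {(S, T). S \<in> F_ground n \<and> T \<in> F_ground n \<and>
     (S = {} \<or> S \<noteq> {} \<and> T \<noteq> {} \<and>
        fst (pair_of S) \<le> fst (pair_of T) \<and> snd (pair_of S) \<le> snd (pair_of T))}"

definition singleton_refinements :: "nat \<Rightarrow> nat set rel set" where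
  "singleton_refinements n = {P. partial_order_on (F_ground n) P \<and> F_order n \<subseteq> P \<and>
     (\<forall>i\<in>{1..n}. \<forall>S\<in>F_ground n. ({i}, S) \<in> P \<or> (S, {i}) \<in> P)}"

definition F1 :: "nat \<Rightarrow> nat set rel set" where
  "F1 n = {P \<in> singleton_refinements n. \<forall>Q\<in>singleton_refinements n. Q \<subseteq> P \<longrightarrow> Q = P}"

definition triangle :: "nat \<Rightarrow> (nat \<times> nat) set" where
  "triangle m = {(i, j). 1 \<le> j \<and> j \<le> i \<and> i \<le> m}"

text \<open>An array is a function on the index set, made canonical outside of it by extensionality, so
  that distinct elements are distinct arrays.\<close>

definition magog_triangles :: "nat \<Rightarrow> (nat \<times> nat \<Rightarrow> nat) set" where
  "magog_triangles m = {M \<in> triangle m \<rightarrow>\<^sub>E {1..}.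
     (\<forall>(i, j)\<in>triangle m. M (i, j) \<le> j) \<and>
     (\<forall>(i, j)\<in>triangle m. (i + 1, j) \<in> triangle m \<longrightarrow> M (i, j) \<le> M (i + 1, j)) \<and>
     (\<forall>(i, j)\<in>triangle m. (i, j + 1) \<in> triangle m \<longrightarrow> M (i, j) \<le> M (i, j + 1))}"

end

(* In a refinement P with comparable singletons the singletons form a chain, so a pair S = {a, b},
   b < a, is located by the largest i with {i} below S in P; this level lies between a and n and is
   monotone in S.  Conversely, let low S and up S be the largest singleton below and the smallest
   singleton above S prescribed by a monotone level function.  Adding to the order of F_{n,2} all
   relations S <= T with up S <= low T gives the least refinement with these levels, and no
   refinement with comparable singletons lies strictly below it.  Hence the minimal refinements
   correspond to the monotone level functions, and reversing both coordinates and the values turns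
   these into magog triangles. *)

theory Submission
  imports Defs
begin

section \<open>The ground set and its order in pair coordinates\<close>

lemma pair_of_singleton: "pair_of {a} = (a, 0)"
  by (simp add: pair_of_def)

lemma pair_of_doubleton:
  assumes "b < a"
  shows "pair_of {a, b} = (a, b)"
proof -
  have "{a, b} - {a} = {b}" "Max {a, b} = a" "card {a, b} = 2"
    using assms by auto
  then show ?thesis
    unfolding pair_of_def by simp
qed

lemma F_ground_cases:
  assumes "S \<in> F_ground n"
  obtains (empty) "S = {}"
    | (singleton) a where "S = {a}" "1 \<le> a" "a \<le> n"
    | (doubleton) a b where "S = {a, b}" "1 \<le> b" "b < a" "a \<le> n"
proof -
  consider "S = {}" | "S \<subseteq> {1..n}" "card S = 1" | "S \<subseteq> {1..n}" "card S = 2"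
    using assms by (auto simp: F_ground_def)
  then show ?thesis
  proof cases
    case 1
    then show ?thesis by (rule empty)
  next
    case 2
    then obtain a where "S = {a}" by (auto simp: card_1_singleton_iff)
    with 2 show ?thesis by (intro singleton[of a]) auto
  next
    case 3
    then obtain x y where "S = {x, y}" "x \<noteq> y" by (auto simp: card_2_iff)
    with 3 show ?thesis
      by (cases "y < x") (auto intro: doubleton[of x y] doubleton[of y x])
  qed
qed

lemma empty_in_F_ground: "{} \<in> F_ground n"
  by (simp add: F_ground_def)

lemma singleton_in_F_ground: "{a} \<in> F_ground n \<longleftrightarrow> 1 \<le> a \<and> a \<le> n"
  by (auto simp: F_ground_def)

lemma doubleton_in_F_ground: "b < a \<Longrightarrow> {a, b} \<in> F_ground n \<longleftrightarrow> 1 \<le> b \<and> a \<le> n"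
  by (auto simp: F_ground_def)

lemma F_order_empty: "({}, S) \<in> F_order n \<longleftrightarrow> S \<in> F_ground n"
  by (auto simp: F_order_def empty_in_F_ground)

lemma F_order_nonempty:
  assumes "S \<noteq> {}"
  shows "(S, T) \<in> F_order n \<longleftrightarrow> S \<in> F_ground n \<and> T \<in> F_ground n \<and> T \<noteq> {} \<and>
    fst (pair_of S) \<le> fst (pair_of T) \<and> snd (pair_of S) \<le> snd (pair_of T)"
  using assms by (auto simp: F_order_def)

text \<open>The second coordinate is 0 only for singletons, since members of a ground set element
  are at least 1; so the pair determines the set.\<close>

lemma pair_of_inject:
  assumes "S \<in> F_ground n" "T \<in> F_ground n" "S \<noteq> {}" "T \<noteq> {}" "pair_of S = pair_of T"
  shows "S = T"
  using assms(3-5)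
  by (cases rule: F_ground_cases[OF assms(1)]; cases rule: F_ground_cases[OF assms(2)])
    (auto simp: pair_of_singleton pair_of_doubleton)

lemma F_order_subset: "F_order n \<subseteq> F_ground n \<times> F_ground n"
  by (auto simp: F_order_def)

lemma F_order_refl: "S \<in> F_ground n \<Longrightarrow> (S, S) \<in> F_order n"
  by (auto simp: F_order_def)

lemma F_order_trans: "(S, T) \<in> F_order n \<Longrightarrow> (T, U) \<in> F_order n \<Longrightarrow> (S, U) \<in> F_order n"
  by (auto simp: F_order_def)

lemma F_order_antisym:
  assumes "(S, T) \<in> F_order n" "(T, S) \<in> F_order n"
  shows "S = T"
proof (cases "S = {} \<or> T = {}")
  case True
  with assms show ?thesis by (auto simp: F_order_def)
next
  case False
  with assms show ?thesis
    by (intro pair_of_inject[of S n T]) (auto simp: F_order_def prod_eq_iff)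
qed

lemma singleton_refinementsD:
  assumes "P \<in> singleton_refinements n"
  shows "P \<subseteq> F_ground n \<times> F_ground n"
    and "\<And>S. S \<in> F_ground n \<Longrightarrow> (S, S) \<in> P"
    and "\<And>S T U. (S, T) \<in> P \<Longrightarrow> (T, U) \<in> P \<Longrightarrow> (S, U) \<in> P"
    and "\<And>S T. (S, T) \<in> P \<Longrightarrow> (T, S) \<in> P \<Longrightarrow> S = T"
    and "F_order n \<subseteq> P"
    and "\<And>i S. 1 \<le> i \<Longrightarrow> i \<le> n \<Longrightarrow> S \<in> F_ground n \<Longrightarrow> ({i}, S) \<in> P \<or> (S, {i}) \<in> P"
proof -
  have po: "partial_order_on (F_ground n) P"
    using assms by (simp add: singleton_refinements_def)
  show "P \<subseteq> F_ground n \<times> F_ground n"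
    using po by (simp add: partial_order_on_def preorder_on_def)
  show "\<And>S. S \<in> F_ground n \<Longrightarrow> (S, S) \<in> P"
    using po by (simp add: partial_order_on_def preorder_on_def refl_on_def)
  show "\<And>S T U. (S, T) \<in> P \<Longrightarrow> (T, U) \<in> P \<Longrightarrow> (S, U) \<in> P"
    using po by (meson partial_order_on_def preorder_on_def transD)
  show "\<And>S T. (S, T) \<in> P \<Longrightarrow> (T, S) \<in> P \<Longrightarrow> S = T"
    using po by (meson partial_order_on_def antisymD)
qed (use assms in \<open>auto simp: singleton_refinements_def\<close>)

section \<open>Levels and the order built from them\<close>

text \<open>Coordinates and values are reversed so that the level of \<open>{a, b}\<close>, which lies
  in \<open>{a..n}\<close>, becomes an entry in column \<open>n + 1 - a\<close> that lies in \<open>{1..n + 1 - a}\<close>. The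
  entry is read off in row \<open>n - b\<close>.\<close>

definition low :: "nat \<Rightarrow> (nat \<times> nat \<Rightarrow> nat) \<Rightarrow> nat set \<Rightarrow> nat" where
  "low n M S = (if S = {} then 0
     else if card S = 2 then n + 1 - M (n - snd (pair_of S), n + 1 - fst (pair_of S))
     else fst (pair_of S))"

text \<open>A doubleton sits in the gap between two consecutive singletons of the chain. The value
  \<open>n + 1\<close> can occur and means that no singleton lies above it.\<close>

definition up :: "nat \<Rightarrow> (nat \<times> nat \<Rightarrow> nat) \<Rightarrow> nat set \<Rightarrow> nat" where
  "up n M S = (if card S = 2 then low n M S + 1 else low n M S)"

text \<open>For nonempty \<open>S\<close> the added pairs are those forced through the singleton
  \<open>{up n M S}\<close>. No transitive closure is taken, because monotone levels make the union
  transitive already.\<close>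

definition magog_order :: "nat \<Rightarrow> (nat \<times> nat \<Rightarrow> nat) \<Rightarrow> nat set rel" where
  "magog_order n M = F_order n \<union>
     {(S, T). S \<in> F_ground n \<and> T \<in> F_ground n \<and> up n M S \<le> low n M T}"

lemma low_empty [simp]: "low n M {} = 0"
  and low_singleton [simp]: "low n M {a} = a"
  by (simp_all add: low_def pair_of_singleton)

lemma low_doubleton [simp]: "b < a \<Longrightarrow> low n M {a, b} = n + 1 - M (n - b, n + 1 - a)"
  by (simp add: low_def pair_of_doubleton)

lemma up_empty [simp]: "up n M {} = 0"
  and up_singleton [simp]: "up n M {a} = a"
  by (simp_all add: up_def)

lemma up_doubleton [simp]: "b < a \<Longrightarrow> up n M {a, b} = low n M {a, b} + 1"
  by (simp add: up_def)

lemma low_le_up: "low n M S \<le> up n M S"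
  and up_le_Suc_low: "up n M S \<le> Suc (low n M S)"
  by (simp_all add: up_def)

lemma magog_triangle_bounds:
  assumes "M \<in> magog_triangles m" "1 \<le> j" "j \<le> i" "i \<le> m"
  shows "1 \<le> M (i, j)" "M (i, j) \<le> j"
  using assms by (auto simp: magog_triangles_def triangle_def PiE_iff)

text \<open>The path goes down column \<open>j\<close> to row \<open>i'\<close> and then along that
  row. Taking row \<open>i\<close> first could leave the triangle, as \<open>j'\<close> may exceed
  \<open>i\<close>.\<close>

lemma magog_triangle_mono:
  assumes M: "M \<in> magog_triangles m" and "1 \<le> j" "j \<le> i" "j \<le> j'" "i \<le> i'" "j' \<le> i'" "i' \<le> m"
  shows "M (i, j) \<le> M (i', j')"
proof -
  have col: "M (i, j) \<le> M (Suc i, j)" if "1 \<le> j" "j \<le> i" "Suc i \<le> m" for i j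
    using M that by (auto simp: magog_triangles_def triangle_def)
  have row: "M (i, j) \<le> M (i, Suc j)" if "1 \<le> j" "Suc j \<le> i" "i \<le> m" for i j
    using M that by (auto simp: magog_triangles_def triangle_def)
  have "M (i, j) \<le> M (i', j)"
    using \<open>i \<le> i'\<close> \<open>i' \<le> m\<close>
  proof (induction i' rule: dec_induct)
    case (step k)
    with col[of j k] assms show ?case by simp
  qed simp
  also have "\<dots> \<le> M (i', j')"
    using \<open>j \<le> j'\<close> \<open>j' \<le> i'\<close>
  proof (induction j' rule: dec_induct)
    case (step k)
    with row[of k i'] assms show ?case by simp
  qed simp
  finally show ?thesis .
qed

section \<open>The order of a magog triangle is a minimal refinement\<close>

context
  fixes n :: nat and M :: "nat \<times> nat \<Rightarrow> nat"
  assumes M: "M \<in> magog_triangles (n - 1)"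
begin

text \<open>With row \<open>n - b\<close> and column \<open>n + 1 - a\<close>, the three assumptions
  are exactly the conditions for an index of the triangle.\<close>

lemma magog_entry_bounds:
  assumes "1 \<le> b" "b < a" "a \<le> n"
  shows "1 \<le> M (n - b, n + 1 - a)" "M (n - b, n + 1 - a) \<le> n + 1 - a"
  using magog_triangle_bounds[OF M, of "n + 1 - a" "n - b"] assms by linarith+

lemma low_le: "S \<in> F_ground n \<Longrightarrow> low n M S \<le> n"
  by (erule F_ground_cases) (use magog_entry_bounds(1) in \<open>fastforce+\<close>)

lemma up_pos: "S \<in> F_ground n \<Longrightarrow> S \<noteq> {} \<Longrightarrow> 1 \<le> up n M S"
  by (erule F_ground_cases) auto

lemma le_low_doubleton:
  assumes "1 \<le> b" "b < a" "a \<le> n"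
  shows "a \<le> low n M {a, b}"
  using magog_entry_bounds[OF assms] assms by simp

lemma low_doubleton_mono:
  assumes "1 \<le> b" "b < a" "b \<le> d" "d < c" "a \<le> c" "c \<le> n"
  shows "low n M {a, b} \<le> low n M {c, d}"
proof -
  have "M (n - d, n + 1 - c) \<le> M (n - b, n + 1 - a)"
    by (rule magog_triangle_mono[OF M]) (use assms in linarith)+
  with assms show ?thesis by (simp add: diff_le_mono2)
qed

text \<open>A doubleton is never below a singleton in \<open>F_order n\<close>, its second
  coordinate being positive. Singleton below doubleton is \<open>le_low_doubleton\<close>; two
  doubletons are \<open>low_doubleton_mono\<close>.\<close>

lemma low_up_mono:
  assumes "(S, T) \<in> F_order n"
  shows "low n M S \<le> low n M T" "up n M S \<le> up n M T"
proof -
  have S: "S \<in> F_ground n" and T: "T \<in> F_ground n"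
    using assms F_order_subset by auto
  have "low n M S \<le> low n M T \<and> up n M S \<le> up n M T"
  proof (cases "S = {}")
    case False
    with assms have T0: "T \<noteq> {}" and le: "fst (pair_of S) \<le> fst (pair_of T)" "snd (pair_of S) \<le> snd (pair_of T)"
      by (auto simp: F_order_nonempty)
    show ?thesis
      using S
    proof (cases rule: F_ground_cases)
      case (singleton a)
      show ?thesis
        using T
      proof (cases rule: F_ground_cases)
        case (doubleton c d)
        with singleton le le_low_doubleton[of d c] show ?thesis
          by (simp add: pair_of_singleton pair_of_doubleton del: low_doubleton)
      qed (use T0 le singleton in \<open>auto simp: pair_of_singleton\<close>)
    next
      case (doubleton a b)
      note ab = this
      show ?thesis
        using T
      proof (cases rule: F_ground_cases)
        case (doubleton c d)
        with ab le low_doubleton_mono[of b a d c] show ?thesis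
          by (simp add: pair_of_doubleton del: low_doubleton)
      qed (use T0 le doubleton in \<open>auto simp: pair_of_singleton pair_of_doubleton\<close>)
    qed (use False in simp)
  qed simp
  then show "low n M S \<le> low n M T" "up n M S \<le> up n M T" by auto
qed

text \<open>Since \<open>low\<close> never exceeds \<open>up\<close>, all four levels coincide. This
  excludes doubletons, and the other sets are determined by their level.\<close>

lemma level_eq_imp_eq:
  assumes "S \<in> F_ground n" "T \<in> F_ground n" "up n M S \<le> low n M T" "up n M T \<le> low n M S"
  shows "S = T"
proof -
  have "low n M S = up n M S" "low n M T = up n M T" "low n M S = low n M T"
    using assms(3,4) low_le_up[of n M S] low_le_up[of n M T] by linarith+
  then show ?thesis
    by (cases rule: F_ground_cases[OF assms(1)]; cases rule: F_ground_cases[OF assms(2)])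
      (auto simp del: low_doubleton)
qed

text \<open>Pairs from \<open>F_order n\<close> satisfy the bound by \<open>low_up_mono\<close>, so
  the order determines \<open>low\<close>.\<close>

lemma singleton_magog_order_iff:
  assumes "1 \<le> i" "i \<le> n" "S \<in> F_ground n"
  shows "({i}, S) \<in> magog_order n M \<longleftrightarrow> i \<le> low n M S"
  using assms low_up_mono(1)[of "{i}" S] by (auto simp: magog_order_def singleton_in_F_ground)

lemma magog_order_singleton_iff:
  assumes "1 \<le> i" "i \<le> n" "S \<in> F_ground n"
  shows "(S, {i}) \<in> magog_order n M \<longleftrightarrow> up n M S \<le> i"
  using assms low_up_mono(2)[of S "{i}"] by (auto simp: magog_order_def singleton_in_F_ground)

lemma magog_order_antisym:
  assumes "(S, T) \<in> magog_order n M" "(T, S) \<in> magog_order n M"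
  shows "S = T"
proof -
  have ST: "S \<in> F_ground n" "T \<in> F_ground n"
    using assms(1) F_order_subset[of n] by (auto simp: magog_order_def)
  \<comment> \<open>Here \<open>up U <= up V <= low U <= low V\<close>, so
    \<open>level_eq_imp_eq\<close> applies.\<close>
  have eq: "U = V" if "U \<in> F_ground n" "V \<in> F_ground n" "(U, V) \<in> F_order n"
    "up n M V \<le> low n M U" for U V
    using low_up_mono[OF that(3)] low_le_up[of n M V] that
    by (intro level_eq_imp_eq) linarith+
  consider "(S, T) \<in> F_order n" "(T, S) \<in> F_order n"
    | "(S, T) \<in> F_order n" "up n M T \<le> low n M S"
    | "(T, S) \<in> F_order n" "up n M S \<le> low n M T"
    | "up n M S \<le> low n M T" "up n M T \<le> low n M S"
    using assms by (auto simp: magog_order_def)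
  then show ?thesis
  proof cases
    case 1
    then show ?thesis by (rule F_order_antisym)
  next
    case 2
    with ST show ?thesis by (intro eq)
  next
    case 3
    with ST show ?thesis by (intro eq[symmetric])
  next
    case 4
    with ST show ?thesis by (intro level_eq_imp_eq)
  qed
qed

text \<open>A step of \<open>F_order n\<close> raises both levels, so it can be absorbed on either
  side of a level comparison; two level comparisons chain through \<open>low <= up\<close>.\<close>

lemma magog_order_trans:
  assumes "(S, T) \<in> magog_order n M" "(T, U) \<in> magog_order n M"
  shows "(S, U) \<in> magog_order n M"
proof -
  have SU: "S \<in> F_ground n" "U \<in> F_ground n"
    using assms F_order_subset[of n] by (auto simp: magog_order_def)
  consider "(S, T) \<in> F_order n" "(T, U) \<in> F_order n"
    | "(S, T) \<in> F_order n" "up n M T \<le> low n M U"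
    | "up n M S \<le> low n M T" "(T, U) \<in> F_order n"
    | "up n M S \<le> low n M T" "up n M T \<le> low n M U"
    using assms by (auto simp: magog_order_def)
  then show ?thesis
  proof cases
    case 1
    then show ?thesis
      using F_order_trans by (auto simp: magog_order_def)
  qed (use SU low_up_mono[of S T] low_up_mono[of T U] low_le_up[of n M T]
        in \<open>auto simp: magog_order_def\<close>)
qed

lemma magog_order_in_refinements: "magog_order n M \<in> singleton_refinements n"
proof -
  have "partial_order_on (F_ground n) (magog_order n M)"
    unfolding partial_order_on_def preorder_on_def
  proof (intro conjI)
    show "magog_order n M \<subseteq> F_ground n \<times> F_ground n"
      using F_order_subset by (auto simp: magog_order_def)
    show "refl_on (F_ground n) (magog_order n M)"
      by (auto simp: refl_on_def magog_order_def F_order_refl)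
    show "trans (magog_order n M)"
      by (rule transI) (rule magog_order_trans)
    show "antisym (magog_order n M)"
      by (rule antisymI) (rule magog_order_antisym)
  qed
  \<comment> \<open>No \<open>i\<close> lies strictly between \<open>low\<close> and
    \<open>up\<close>, which differ by at most 1.\<close>
  moreover have "({i}, S) \<in> magog_order n M \<or> (S, {i}) \<in> magog_order n M"
    if "i \<in> {1..n}" "S \<in> F_ground n" for i S
    using that up_le_Suc_low[of n M S]
    by (auto simp: singleton_magog_order_iff magog_order_singleton_iff)
  ultimately show ?thesis
    by (auto simp: singleton_refinements_def magog_order_def)
qed

text \<open>Every added pair with nonempty \<open>S\<close> factors through a singleton, so
  comparisons with singletons suffice. This serves both minimality and surjectivity.\<close>

lemma magog_order_least:
  assumes Q: "Q \<in> singleton_refinements n"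
    and low: "\<And>i S. 1 \<le> i \<Longrightarrow> i \<le> n \<Longrightarrow> S \<in> F_ground n \<Longrightarrow> i \<le> low n M S \<Longrightarrow> ({i}, S) \<in> Q"
    and up: "\<And>i S. 1 \<le> i \<Longrightarrow> i \<le> n \<Longrightarrow> S \<in> F_ground n \<Longrightarrow> up n M S \<le> i \<Longrightarrow> (S, {i}) \<in> Q"
  shows "magog_order n M \<subseteq> Q"
proof (rule subrelI)
  fix S T assume ST: "(S, T) \<in> magog_order n M"
  note refQ = singleton_refinementsD[OF Q]
  show "(S, T) \<in> Q"
  proof (cases "(S, T) \<in> F_order n")
    case True
    with refQ(5) show ?thesis by auto
  next
    case False
    with ST have *: "S \<in> F_ground n" "T \<in> F_ground n" "up n M S \<le> low n M T" "S \<noteq> {}"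
      by (auto simp: magog_order_def F_order_empty)
    \<comment> \<open>The bound by \<open>low n M T\<close> rules out the value
      \<open>n + 1\<close>, so \<open>{up n M S}\<close> is a genuine singleton of the ground
      set.\<close>
    have bounds: "1 \<le> up n M S" "up n M S \<le> n"
      using up_pos[of S] low_le[of T] * by auto
    have "(S, {up n M S}) \<in> Q" "({up n M S}, T) \<in> Q"
      using up[OF bounds] low[OF bounds] * by auto
    then show ?thesis
      by (rule refQ(3))
  qed
qed

text \<open>If \<open>Q\<close> dropped a comparison with a singleton, comparability would put the
  opposite one into \<open>Q\<close>, hence into the larger order; the levels then force
  \<open>S = {i}\<close>, against reflexivity.\<close>

lemma magog_order_minimal:
  assumes Q: "Q \<in> singleton_refinements n" and sub: "Q \<subseteq> magog_order n M"
  shows "Q = magog_order n M"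
proof
  note refQ = singleton_refinementsD[OF Q]
  show "magog_order n M \<subseteq> Q"
  proof (rule magog_order_least[OF Q])
    fix i S assume i: "1 \<le> i" "i \<le> n" and S: "S \<in> F_ground n"
    have i': "{i} \<in> F_ground n" using i by (simp add: singleton_in_F_ground)
    show "({i}, S) \<in> Q" if "i \<le> low n M S"
    proof (rule ccontr)
      assume n: "({i}, S) \<notin> Q"
      with refQ(6)[OF i S] sub have "up n M S \<le> i"
        using magog_order_singleton_iff[OF i S] by auto
      with that S i' have "S = {i}" by (intro level_eq_imp_eq) auto
      with n refQ(2) S show False by auto
    qed
    show "(S, {i}) \<in> Q" if "up n M S \<le> i"
    proof (rule ccontr)
      assume n: "(S, {i}) \<notin> Q"
      with refQ(6)[OF i S] sub have "i \<le> low n M S"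
        using singleton_magog_order_iff[OF i S] by auto
      with that S i' have "S = {i}" by (intro level_eq_imp_eq) auto
      with n refQ(2) S show False by auto
    qed
  qed
qed (rule sub)

lemma magog_order_in_F1: "magog_order n M \<in> F1 n"
  using magog_order_in_refinements magog_order_minimal by (auto simp: F1_def)

end

section \<open>Recovering the triangle from its order\<close>

lemma low_eq_if_magog_order_eq:
  assumes M: "M \<in> magog_triangles (n - 1)" and M': "M' \<in> magog_triangles (n - 1)"
    and eq: "magog_order n M = magog_order n M'" and S: "S \<in> F_ground n"
  shows "low n M S = low n M' S"
proof -
  have iff: "i \<le> low n M S \<longleftrightarrow> i \<le> low n M' S" if "1 \<le> i" "i \<le> n" for i
    using singleton_magog_order_iff[OF M that S] singleton_magog_order_iff[OF M' that S] eq
    by simp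
  show ?thesis
    using iff[of "low n M S"] iff[of "low n M' S"] low_le[OF M S] low_le[OF M' S]
    by (cases "low n M S = 0"; cases "low n M' S = 0") auto
qed

lemma magog_order_inject:
  assumes M: "M \<in> magog_triangles (n - 1)" and M': "M' \<in> magog_triangles (n - 1)"
    and eq: "magog_order n M = magog_order n M'"
  shows "M = M'"
proof (rule PiE_ext)
  show "M \<in> triangle (n - 1) \<rightarrow>\<^sub>E {1..}" "M' \<in> triangle (n - 1) \<rightarrow>\<^sub>E {1..}"
    using M M' by (auto simp: magog_triangles_def)
next
  fix x assume "x \<in> triangle (n - 1)"
  then obtain i j where x: "x = (i, j)" and ij: "1 \<le> j" "j \<le> i" "i \<le> n - 1"
    by (auto simp: triangle_def)
  have less: "n - i < n + 1 - j"
    using ij by linarith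
  have "{n + 1 - j, n - i} \<in> F_ground n"
    unfolding doubleton_in_F_ground[OF less] using ij by linarith
  from low_eq_if_magog_order_eq[OF M M' eq this] have "n + 1 - M (i, j) = n + 1 - M' (i, j)"
    using less ij by simp
  \<comment> \<open>These bounds allow the truncated subtraction to be cancelled.\<close>
  moreover have "M (i, j) \<le> n" "M' (i, j) \<le> n"
    using magog_triangle_bounds(2)[OF M ij] magog_triangle_bounds(2)[OF M' ij] ij by linarith+
  ultimately show "M x = M' x"
    unfolding x by linarith
qed

section \<open>From refinements back to magog triangles\<close>

definition level :: "nat \<Rightarrow> nat set rel \<Rightarrow> nat set \<Rightarrow> nat" where
  "level n P S = Max {i \<in> {1..n}. ({i}, S) \<in> P}"

text \<open>Inverts the coordinate change in \<open>low\<close>, with \<open>a = n + 1 - j\<close>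
  and \<open>b = n - i\<close>; the restricted abstraction makes the array extensional.\<close>

definition magog_of :: "nat \<Rightarrow> nat set rel \<Rightarrow> nat \<times> nat \<Rightarrow> nat" where
  "magog_of n P = (\<lambda>(i, j)\<in>triangle (n - 1). n + 1 - level n P {n + 1 - j, n - i})"

context
  fixes n :: nat and P :: "nat set rel"
  assumes P: "P \<in> singleton_refinements n"
begin

text \<open>As \<open>{a}\<close> is below \<open>{a, b}\<close> already in
  \<open>F_order n\<close>, the maximum is over a nonempty set containing \<open>a\<close>.\<close>

lemma level_bounds:
  assumes "1 \<le> b" "b < a" "a \<le> n"
  shows "a \<le> level n P {a, b}" "level n P {a, b} \<le> n" "({level n P {a, b}}, {a, b}) \<in> P"
proof -
  let ?A = "{i \<in> {1..n}. ({i}, {a, b}) \<in> P}"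
  have "({a}, {a, b}) \<in> F_order n"
    using assms
    by (simp add: F_order_nonempty pair_of_singleton pair_of_doubleton
        singleton_in_F_ground doubleton_in_F_ground)
  with singleton_refinementsD(5)[OF P] assms have a: "a \<in> ?A" by auto
  then have "level n P {a, b} \<in> ?A"
    unfolding level_def by (intro Max_in) auto
  then show "level n P {a, b} \<le> n" "({level n P {a, b}}, {a, b}) \<in> P" by auto
  from a show "a \<le> level n P {a, b}"
    unfolding level_def by (intro Max_ge) auto
qed

text \<open>The singletons form a chain, so those below \<open>{a, b}\<close> are an initial segment
  of it.\<close>

lemma le_level_iff:
  assumes "1 \<le> b" "b < a" "a \<le> n" "1 \<le> i" "i \<le> n"
  shows "i \<le> level n P {a, b} \<longleftrightarrow> ({i}, {a, b}) \<in> P"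
proof
  note level = level_bounds[OF assms(1-3)]
  show "({i}, {a, b}) \<in> P" if "i \<le> level n P {a, b}"
  proof -
    have "({i}, {level n P {a, b}}) \<in> F_order n"
      using that level assms by (simp add: F_order_nonempty pair_of_singleton singleton_in_F_ground)
    with singleton_refinementsD(3,5)[OF P] level(3) show ?thesis by blast
  qed
  show "i \<le> level n P {a, b}" if "({i}, {a, b}) \<in> P"
    unfolding level_def using that assms by (intro Max_ge) auto
qed

lemma level_mono:
  assumes "1 \<le> b" "b < a" "b \<le> d" "d < c" "a \<le> c" "c \<le> n"
  shows "level n P {a, b} \<le> level n P {c, d}"
proof -
  have "a \<le> n" "1 \<le> d" using assms by auto
  note level = level_bounds[OF assms(1,2) \<open>a \<le> n\<close>]
  have "({a, b}, {c, d}) \<in> F_order n"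
    using assms by (simp add: F_order_nonempty pair_of_doubleton doubleton_in_F_ground)
  then have "({level n P {a, b}}, {c, d}) \<in> P"
    using singleton_refinementsD(3,5)[OF P] level(3) by blast
  with le_level_iff[OF \<open>1 \<le> d\<close> \<open>d < c\<close> \<open>c \<le> n\<close>] level assms show ?thesis by auto
qed

lemma magog_of_in_magog_triangles: "magog_of n P \<in> magog_triangles (n - 1)"
proof -
  have bounds: "n + 1 - j \<le> level n P {n + 1 - j, n - i}" "level n P {n + 1 - j, n - i} \<le> n"
    if "(i, j) \<in> triangle (n - 1)" for i j
    using level_bounds[of "n - i" "n + 1 - j"] that by (auto simp: triangle_def)
  \<comment> \<open>Larger indices mean smaller \<open>a\<close> and \<open>b\<close>, hence a
    smaller level and a larger entry. Rows and columns are both special cases.\<close>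
  have mono: "magog_of n P (i, j) \<le> magog_of n P (i', j')"
    if "(i, j) \<in> triangle (n - 1)" "(i', j') \<in> triangle (n - 1)" "i \<le> i'" "j \<le> j'" for i j i' j'
  proof -
    have "level n P {n + 1 - j', n - i'} \<le> level n P {n + 1 - j, n - i}"
      using that by (intro level_mono) (auto simp: triangle_def)
    with that show ?thesis by (simp add: magog_of_def diff_le_mono2)
  qed
  have "1 \<le> magog_of n P (i, j)" "magog_of n P (i, j) \<le> j" if "(i, j) \<in> triangle (n - 1)" for i j
    using bounds[OF that] that by (auto simp: magog_of_def)
  moreover have "magog_of n P \<in> extensional (triangle (n - 1))"
    by (simp add: magog_of_def)
  ultimately show ?thesis
    using mono by (auto simp: magog_triangles_def PiE_def)
qed

lemma low_magog_of:
  assumes "1 \<le> b" "b < a" "a \<le> n"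
  shows "low n (magog_of n P) {a, b} = level n P {a, b}"
proof -
  have "(n - b, n + 1 - a) \<in> triangle (n - 1)" "n + 1 - (n + 1 - a) = a" "n - (n - b) = b"
    using assms by (auto simp: triangle_def)
  with level_bounds[OF assms] assms show ?thesis by (simp add: magog_of_def)
qed

lemma magog_order_magog_of_subset: "magog_order n (magog_of n P) \<subseteq> P"
proof (rule magog_order_least[OF magog_of_in_magog_triangles P])
  note refP = singleton_refinementsD[OF P]
  fix i S assume i: "1 \<le> i" "i \<le> n" and S: "S \<in> F_ground n"
  have F: "({i}, {a}) \<in> P" if "i \<le> a" "a \<le> n" for a
    using refP(5) that i by (auto simp: F_order_nonempty pair_of_singleton singleton_in_F_ground)
  have F': "({a}, {i}) \<in> P" if "1 \<le> a" "a \<le> i" for a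
    using refP(5) that i by (auto simp: F_order_nonempty pair_of_singleton singleton_in_F_ground)
  have E: "({}, {i}) \<in> P"
    using refP(5) i by (auto simp: F_order_empty singleton_in_F_ground)
  show "({i}, S) \<in> P" if "i \<le> low n (magog_of n P) S"
    using S
  proof (cases rule: F_ground_cases)
    case (doubleton a b)
    with that i show ?thesis by (simp add: low_magog_of le_level_iff del: low_doubleton)
  qed (use that i F in auto)
  show "(S, {i}) \<in> P" if "up n (magog_of n P) S \<le> i"
    using S
  proof (cases rule: F_ground_cases)
    case (doubleton a b)
    \<comment> \<open>With \<open>{i}\<close> above the level, \<open>{i}\<close> is not below
      \<open>S\<close> in \<open>P\<close>, so comparability puts \<open>S\<close> below
      \<open>{i}\<close>.\<close>
    with that i have "\<not> i \<le> level n P S" by (simp add: low_magog_of del: low_doubleton)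
    with le_level_iff[of b a i] doubleton i have "({i}, S) \<notin> P" by simp
    with refP(6)[OF i S] show ?thesis by blast
  qed (use that F' E in auto)
qed

end

section \<open>The bijection\<close>

lemma bij_betw_magog_order: "bij_betw (magog_order n) (magog_triangles (n - 1)) (F1 n)"
proof (rule bij_betw_imageI)
  show "inj_on (magog_order n) (magog_triangles (n - 1))"
    by (rule inj_onI) (rule magog_order_inject)
  show "magog_order n ` magog_triangles (n - 1) = F1 n"
  proof
    show "magog_order n ` magog_triangles (n - 1) \<subseteq> F1 n"
      using magog_order_in_F1 by auto
    show "F1 n \<subseteq> magog_order n ` magog_triangles (n - 1)"
    proof
      fix P assume F1: "P \<in> F1 n"
      then have P: "P \<in> singleton_refinements n"
        by (simp add: F1_def)
      note magog = magog_of_in_magog_triangles[OF P]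
      \<comment> \<open>Minimality of \<open>P\<close> turns the inclusion into equality.\<close>
      have "magog_order n (magog_of n P) = P"
        using F1 magog_order_in_refinements[OF magog] magog_order_magog_of_subset[OF P]
        by (auto simp: F1_def)
      with magog show "P \<in> magog_order n ` magog_triangles (n - 1)" by blast
    qed
  qed
qed

theorem mainTheorem3:
  fixes n :: nat
  assumes "n \<ge> 2"
  shows "(\<exists>f. bij_betw f (F1 n) (magog_triangles (n - 1))) \<and>
         card (F1 n) = card (magog_triangles (n - 1))"
  using bij_betw_inv_into[OF bij_betw_magog_order[of n]]
    bij_betw_same_card[OF bij_betw_magog_order[of n]]
  by auto

end
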